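(* Let $\widetilde V(\Omega)$ be the space of ultrafunctions generated by $V(\Omega)$. Given a distribution $T\in\mathcal D'(\Omega)$, there exists an ultrafunction $u\in\widetilde V(\Omega)$ such that $$\forall\varphi\in\mathcal D(\Omega),\quad \int^*u(x)\varphi^*(x)\,dx=\langle T,\varphi\rangle .$$
   Context: $\Lambda$-limit. Let $\mathbb U=\bigcup_{n\ge 0}\mathbb U_n$ with $\mathbb U_0=\mathbb R$, $\mathbb U_{n+1}=\mathbb U_n\cup\mathcal P(\mathbb U_n)$ (pairs are Kuratowski pairs, functions and relations are identified with their graphs). Let $\mathcal F$ be the set of finite subsets of $\mathbb U$; a net is a map defined on $\mathcal F$. Fix a superreal field $\mathbb K$ (an ordered field properly extending $\mathbb R$) and an operation assigning to each net $\varphi:\mathcal F\to\mathbb R$ a unique element $\lim_{\lambda\uparrow\mathbb U}\varphi(\lambda)\in\mathbb K$ (its $\Lambda$-limit) such that: ($\Lambda$-1) every element of $\mathbb K$ is the $\Lambda$-limit of some real net; ($\Lambda$-2) if there are $\lambda_0\in\mathcal F$, $r\in\mathbb R$ with $\varphi(\lambda)=r$ for all $\lambda\supset\lambda_0$, then the $\Lambda$-limit of $\varphi$ is $r$; ($\Lambda$-3) the $\Lambda$-limit of a sum (product) of two real nets is the sum (product) of their $\Lambda$-limits. For nets $\varphi:\mathcal F\to\mathbb U_n$, $n\ge1$, define inductively $\lim_{\lambda\uparrow\mathbb U}\varphi(\lambda)=\{\lim_{\lambda\uparrow\mathbb U}\psi(\lambda)\mid \psi:\mathcal F\to\mathbb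 U_{n-1},\ \psi(\lambda)\in\varphi(\lambda)\ \forall\lambda\}$. The natural extension $E^*$ of a set $E$ is the $\Lambda$-limit of the constant net $E$; thus $\mathbb K=\mathbb R^*$. A function $f:E\to F$ extends to $f^*:E^*\to F^*$ (its natural extension) with $f^*(\lim\varphi(\lambda))=\lim f(\varphi(\lambda))$, and a $\Lambda$-limit $u$ of functions $u_\lambda:E\to F$ is the function $u:E^*\to F^*$ with $u(\lim x_\lambda)=\lim u_\lambda(x_\lambda)$. Ultrafunctions. $\Omega$ is a set in $\mathbb R^N$, and $V(\Omega)$ is a (real or complex) vector space with $\mathcal D(\overline\Omega)\subseteq V(\Omega)\subseteq L^2(\Omega)\cap\mathcal C(\overline\Omega)$, where $\mathcal D(\overline\Omega)$ is the set of infinitely differentiable functions with compact support defined on $\overline\Omega$ and $\mathcal C(\overline\Omega)$ the set of continuous functions on $\overline\Omega$. Put $V_\lambda(\Omega)=\mathrm{Span}(V(\Omega)\cap\lambda)$ and $\widetilde V(\Omega)=\lim_{\lambda\uparrow\mathbb U}V_\lambda(\Omega)$, the space of ultrafunctions generated by $V(\Omega)$; its elements are called ultrafunctions. $\int^*$ is the natural extension of the Lebesgue integral $\int:L^1(\Omega)\to\mathbb C$. $\mathcal D(\Omega)$ is the set of infinitely differentiable functions with compact support defined on $\Omega$, and $\mathcal D'(\Omega)$ is its topological dual, namely the set of distributions on $\Omega$. *)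

theory Defs
  imports "HOL-Analysis.Analysis" "HOL-Library.FSet"
begin

section \<open>The universe and the \<open>\<Lambda>\<close>-limit\<close>

text \<open>
  The universe is a type \<open>'u\<close> whose elements are either real numbers (the values of \<open>atom\<close>,
  urelements without members) or sets (\<open>elts x\<close> is the set of members of \<open>x\<close>).
  \<open>universe_level atom elts n\<close> is the \<open>n\<close>-th level of the superstructure over the reals.
  The predicate \<open>superstructure\<close> says that every level is closed under the full power set in the
  next level and that \<open>'u\<close> is the union of its levels.  The pure type constructors of HOL give no
  type of this cardinality, so \<open>'u\<close> is left as a type variable.
\<close>

primrec universe_level :: "(real \<Rightarrow> 'u) \<Rightarrow> ('u \<Rightarrow> 'u set) \<Rightarrow> nat \<Rightarrow> 'u set" where
  "universe_level atom elts 0 = range atom"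
| "universe_level atom elts (Suc n) =
     universe_level atom elts n \<union> {x. x \<notin> range atom \<and> elts x \<subseteq> universe_level atom elts n}"

definition superstructure :: "(real \<Rightarrow> 'u) \<Rightarrow> ('u \<Rightarrow> 'u set) \<Rightarrow> bool" where
  "superstructure atom elts \<longleftrightarrow>
     inj atom \<and>
     (\<forall>r. elts (atom r) = {}) \<and>
     inj_on elts (- range atom) \<and>
     (\<forall>n. \<forall>A. A \<subseteq> universe_level atom elts n \<longrightarrow> (\<exists>x. x \<notin> range atom \<and> elts x = A)) \<and>
     (\<Union>n. universe_level atom elts n) = UNIV"

text \<open>
  Nets are functions on \<open>'u fset\<close>, the finite subsets of the universe.  The superreal field is a
  linearly ordered field \<open>'k\<close> which contains the reals via \<open>of_real\<close>.
\<close>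

definition lambda_limit ::
  "(('u fset \<Rightarrow> real) \<Rightarrow> 'k::{linordered_field, real_field}) \<Rightarrow> bool" where
  "lambda_limit llim \<longleftrightarrow>
     range (of_real :: real \<Rightarrow> 'k) \<noteq> UNIV \<and>
     (\<forall>\<xi>. \<exists>\<phi>. llim \<phi> = \<xi>) \<and>
     (\<forall>\<phi> A0 r. (\<forall>A. A0 |\<subseteq>| A \<longrightarrow> \<phi> A = r) \<longrightarrow> llim \<phi> = of_real r) \<and>
     (\<forall>\<phi> \<psi>. llim (\<lambda>A. \<phi> A + \<psi> A) = llim \<phi> + llim \<psi>) \<and>
     (\<forall>\<phi> \<psi>. llim (\<lambda>A. \<phi> A * \<psi> A) = llim \<phi> * llim \<psi>)"

text \<open>The natural extension of \<open>\<complex> = \<real> \<times> \<real>\<close>, with the natural extension of its product.\<close>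

datatype 'k star_complex = StarComplex (SRe: 'k) (SIm: 'k)

instantiation star_complex :: (comm_ring) "{zero, times}"
begin

definition "0 = StarComplex 0 0"

definition "z * w =
  StarComplex (SRe z * SRe w - SIm z * SIm w) (SRe z * SIm w + SIm z * SRe w)"

instance ..

end

definition star_of_complex :: "complex \<Rightarrow> 'k::real_field star_complex" where
  "star_of_complex z = StarComplex (of_real (Re z)) (of_real (Im z))"

text \<open>
  \<open>\<Lambda>\<close>-limits of complex nets and of nets of points are taken componentwise.
  A net \<open>f\<close> of functions with domain \<open>E\<close> has as its limit the function on \<open>star_set llim E\<close> sending
  the limit of a net \<open>x\<close> in \<open>E\<close> to the limit of \<open>f A (x A)\<close>.  A function whose domain is a subset
  of its HOL domain type has the value \<open>0\<close> outside that subset.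
\<close>

definition lim_complex ::
  "(('u fset \<Rightarrow> real) \<Rightarrow> 'k) \<Rightarrow> ('u fset \<Rightarrow> complex) \<Rightarrow> 'k star_complex" where
  "lim_complex llim z = StarComplex (llim (\<lambda>A. Re (z A))) (llim (\<lambda>A. Im (z A)))"

definition lim_vec ::
  "(('u fset \<Rightarrow> real) \<Rightarrow> 'k) \<Rightarrow> ('u fset \<Rightarrow> real ^ 'n) \<Rightarrow> 'k ^ 'n" where
  "lim_vec llim x = (\<chi> i. llim (\<lambda>A. x A $ i))"

definition star_set ::
  "(('u fset \<Rightarrow> real) \<Rightarrow> 'k) \<Rightarrow> (real ^ 'n) set \<Rightarrow> ('k ^ 'n) set" where
  "star_set llim E = {lim_vec llim x | x. \<forall>A. x A \<in> E}"

definition lim_fun ::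
  "(('u fset \<Rightarrow> real) \<Rightarrow> 'k::comm_ring) \<Rightarrow> (real ^ 'n) set \<Rightarrow>
   ('u fset \<Rightarrow> real ^ 'n \<Rightarrow> complex) \<Rightarrow> 'k ^ 'n \<Rightarrow> 'k star_complex" where
  "lim_fun llim E f \<xi> =
     (if \<xi> \<in> star_set llim E
      then THE \<eta>. \<exists>x. (\<forall>A. x A \<in> E) \<and> \<xi> = lim_vec llim x \<and> \<eta> = lim_complex llim (\<lambda>A. f A (x A))
      else 0)"

definition star_fun ::
  "(('u fset \<Rightarrow> real) \<Rightarrow> 'k::comm_ring) \<Rightarrow> (real ^ 'n) set \<Rightarrow>
   (real ^ 'n \<Rightarrow> complex) \<Rightarrow> 'k ^ 'n \<Rightarrow> 'k star_complex" where
  "star_fun llim E f = lim_fun llim E (\<lambda>_. f)"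


section \<open>Functions as elements of the universe\<close>

definition mk_set :: "(real \<Rightarrow> 'u) \<Rightarrow> ('u \<Rightarrow> 'u set) \<Rightarrow> 'u set \<Rightarrow> 'u" where
  "mk_set atom elts A = (THE x. x \<notin> range atom \<and> elts x = A)"

definition kuratowski_pair :: "(real \<Rightarrow> 'u) \<Rightarrow> ('u \<Rightarrow> 'u set) \<Rightarrow> 'u \<Rightarrow> 'u \<Rightarrow> 'u" where
  "kuratowski_pair atom elts a b =
     mk_set atom elts {mk_set atom elts {a}, mk_set atom elts {a, b}}"

text \<open>A complex number is a pair of reals, except that real numbers are kept as urelements.\<close>

definition complex_code :: "(real \<Rightarrow> 'u) \<Rightarrow> ('u \<Rightarrow> 'u set) \<Rightarrow> complex \<Rightarrow> 'u" where
  "complex_code atom elts z =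
     (if z \<in> \<real> then atom (Re z) else kuratowski_pair atom elts (atom (Re z)) (atom (Im z)))"

text \<open>
  A point of \<open>\<real>\<^sup>N\<close> is a function from \<open>{1, \<dots>, N}\<close> to the reals; as the index type \<open>'n\<close> has no
  canonical order, an enumeration of it is fixed.
\<close>

definition coord_index :: "'n::finite \<Rightarrow> nat" where
  "coord_index = (SOME e. bij_betw e UNIV {1..CARD('n)})"

definition vec_code :: "(real \<Rightarrow> 'u) \<Rightarrow> ('u \<Rightarrow> 'u set) \<Rightarrow> real ^ 'n \<Rightarrow> 'u" where
  "vec_code atom elts x =
     mk_set atom elts
       (range (\<lambda>i. kuratowski_pair atom elts (atom (real (coord_index i))) (atom (x $ i))))"

definition fun_code ::
  "(real \<Rightarrow> 'u) \<Rightarrow> ('u \<Rightarrow> 'u set) \<Rightarrow> (real ^ 'n) set \<Rightarrow> (real ^ 'n \<Rightarrow> complex) \<Rightarrow> 'u" where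
  "fun_code atom elts E f =
     mk_set atom elts
       ((\<lambda>x. kuratowski_pair atom elts (vec_code atom elts x) (complex_code atom elts (f x))) ` E)"


section \<open>Function spaces\<close>

text \<open>
  Below, \<open>F\<close> is the set of values of the functions and \<open>S\<close> the field of scalars; each is the set of
  all complex numbers or the set \<open>\<real>\<close> of real ones.
\<close>

primrec iterated_partial ::
  "'n list \<Rightarrow> (real ^ 'n \<Rightarrow> complex) \<Rightarrow> real ^ 'n \<Rightarrow> complex" where
  "iterated_partial [] f = f"
| "iterated_partial (i # is) f =
     (\<lambda>x. frechet_derivative (iterated_partial is f) (at x) (axis i 1))"

definition infinitely_differentiable :: "(real ^ 'n \<Rightarrow> complex) \<Rightarrow> bool" where
  "infinitely_differentiable f \<longleftrightarrow> (\<forall>is. iterated_partial is f differentiable_on UNIV)"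

definition test_functions_in ::
  "complex set \<Rightarrow> (real ^ 'n) set \<Rightarrow> (real ^ 'n \<Rightarrow> complex) set" where
  "test_functions_in F K = {\<phi>. infinitely_differentiable \<phi> \<and> range \<phi> \<subseteq> F \<and> closure {x. \<phi> x \<noteq> 0} \<subseteq> K}"

text \<open>\<open>\<D>(\<Omega>)\<close>; its elements are extended by \<open>0\<close> to the whole space.\<close>

definition test_functions ::
  "complex set \<Rightarrow> (real ^ 'n) set \<Rightarrow> (real ^ 'n \<Rightarrow> complex) set" where
  "test_functions F \<Omega> = {\<phi> \<in> test_functions_in F \<Omega>. compact (closure {x. \<phi> x \<noteq> 0})}"

text \<open>
  The space \<open>\<D>\<close> of the closure of \<open>\<Omega>\<close>: the restrictions to the closure of smooth, compactly
  supported functions on the whole space.  They need not vanish on the boundary.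
\<close>

definition test_functions_closure ::
  "complex set \<Rightarrow> (real ^ 'n) set \<Rightarrow> (real ^ 'n \<Rightarrow> complex) set" where
  "test_functions_closure F \<Omega> =
     (\<lambda>\<phi> x. if x \<in> closure \<Omega> then \<phi> x else 0) ` test_functions F UNIV"

definition continuous_functions_closure ::
  "complex set \<Rightarrow> (real ^ 'n) set \<Rightarrow> (real ^ 'n \<Rightarrow> complex) set" where
  "continuous_functions_closure F \<Omega> =
     {f. continuous_on (closure \<Omega>) f \<and> range f \<subseteq> F \<and> (\<forall>x. x \<notin> closure \<Omega> \<longrightarrow> f x = 0)}"

definition L1_functions :: "(real ^ 'n) set \<Rightarrow> (real ^ 'n \<Rightarrow> complex) set" where
  "L1_functions \<Omega> = {f. integrable (lebesgue_on \<Omega>) f}"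

definition L2_functions :: "(real ^ 'n) set \<Rightarrow> (real ^ 'n \<Rightarrow> complex) set" where
  "L2_functions \<Omega> =
     {f \<in> borel_measurable (lebesgue_on \<Omega>). integrable (lebesgue_on \<Omega>) (\<lambda>x. (norm (f x))\<^sup>2)}"

definition function_subspace :: "complex set \<Rightarrow> (real ^ 'n \<Rightarrow> complex) set \<Rightarrow> bool" where
  "function_subspace S V \<longleftrightarrow>
     (\<lambda>_. 0) \<in> V \<and>
     (\<forall>f\<in>V. \<forall>g\<in>V. (\<lambda>x. f x + g x) \<in> V) \<and>
     (\<forall>c\<in>S. \<forall>f\<in>V. (\<lambda>x. c * f x) \<in> V)"

definition function_span ::
  "complex set \<Rightarrow> (real ^ 'n \<Rightarrow> complex) set \<Rightarrow> (real ^ 'n \<Rightarrow> complex) set" where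
  "function_span S B = {(\<lambda>x. \<Sum>f\<in>t. c f * f x) | t c. finite t \<and> t \<subseteq> B \<and> (\<forall>f\<in>t. c f \<in> S)}"

definition generating_space ::
  "complex set \<Rightarrow> complex set \<Rightarrow> (real ^ 'n) set \<Rightarrow> (real ^ 'n \<Rightarrow> complex) set \<Rightarrow> bool" where
  "generating_space S F \<Omega> V \<longleftrightarrow>
     function_subspace S V \<and>
     test_functions_closure F \<Omega> \<subseteq> V \<and>
     V \<subseteq> L2_functions \<Omega> \<inter> continuous_functions_closure F \<Omega>"


section \<open>Ultrafunctions\<close>

definition V_fin ::
  "(real \<Rightarrow> 'u) \<Rightarrow> ('u \<Rightarrow> 'u set) \<Rightarrow> complex set \<Rightarrow> (real ^ 'n) set \<Rightarrow>
   (real ^ 'n \<Rightarrow> complex) set \<Rightarrow> 'u fset \<Rightarrow> (real ^ 'n \<Rightarrow> complex) set" where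
  "V_fin atom elts S \<Omega> V A = function_span S {f \<in> V. fun_code atom elts (closure \<Omega>) f \<in> fset A}"

definition ultrafunctions ::
  "(real \<Rightarrow> 'u) \<Rightarrow> ('u \<Rightarrow> 'u set) \<Rightarrow> (('u fset \<Rightarrow> real) \<Rightarrow> 'k::comm_ring) \<Rightarrow> complex set \<Rightarrow>
   (real ^ 'n) set \<Rightarrow> (real ^ 'n \<Rightarrow> complex) set \<Rightarrow> ('k ^ 'n \<Rightarrow> 'k star_complex) set" where
  "ultrafunctions atom elts llim S \<Omega> V =
     {lim_fun llim (closure \<Omega>) u | u. \<forall>A. u A \<in> V_fin atom elts S \<Omega> V A}"

text \<open>
  The natural extension of the Lebesgue integral on \<open>L\<^sup>1(\<Omega>)\<close>: it sends the limit of a net \<open>f\<close> of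
  integrable functions to the limit of their integrals.
\<close>

definition star_integral ::
  "(('u fset \<Rightarrow> real) \<Rightarrow> 'k::comm_ring) \<Rightarrow> (real ^ 'n) set \<Rightarrow>
   ('k ^ 'n \<Rightarrow> 'k star_complex) \<Rightarrow> 'k star_complex" where
  "star_integral llim \<Omega> g =
     (THE \<eta>. \<exists>f. (\<forall>A. f A \<in> L1_functions \<Omega>) \<and>
                 (\<forall>\<xi>\<in>star_set llim \<Omega>. g \<xi> = lim_fun llim \<Omega> f \<xi>) \<and>
                 \<eta> = lim_complex llim (\<lambda>A. \<integral>x. f A x \<partial>lebesgue_on \<Omega>))"


section \<open>Distributions\<close>

text \<open>
  The usual topologies on test functions: \<open>test_open_in F K W\<close> says that the trace of \<open>W\<close> on the
  functions supported in the compact set \<open>K\<close> is open for uniform convergence of all partial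
  derivatives; the topology of \<open>\<D>(\<Omega>)\<close> is generated by the translates of the convex balanced
  sets with open traces for all compact subsets of \<open>\<Omega>\<close>.
\<close>

definition test_open_in ::
  "complex set \<Rightarrow> (real ^ 'n) set \<Rightarrow> (real ^ 'n \<Rightarrow> complex) set \<Rightarrow> bool" where
  "test_open_in F K W \<longleftrightarrow>
     (\<forall>\<phi> \<in> W \<inter> test_functions_in F K. \<exists>m::nat. \<exists>\<epsilon>>0. \<forall>\<psi> \<in> test_functions_in F K.
        (\<forall>is x. length is \<le> m \<longrightarrow> norm (iterated_partial is (\<lambda>y. \<psi> y - \<phi> y) x) < \<epsilon>) \<longrightarrow> \<psi> \<in> W)"

definition test_neighbourhoods ::
  "complex set \<Rightarrow> (real ^ 'n) set \<Rightarrow> (real ^ 'n \<Rightarrow> complex) set set" where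
  "test_neighbourhoods F \<Omega> =
     {W. W \<subseteq> test_functions F \<Omega> \<and> (\<lambda>_. 0) \<in> W \<and>
         (\<forall>\<phi>\<in>W. \<forall>\<psi>\<in>W. \<forall>t\<in>{0..1}. (\<lambda>x. of_real (1 - t) * \<phi> x + of_real t * \<psi> x) \<in> W) \<and>
         (\<forall>\<phi>\<in>W. \<forall>c\<in>F. norm c \<le> 1 \<longrightarrow> (\<lambda>x. c * \<phi> x) \<in> W) \<and>
         (\<forall>K. compact K \<and> K \<subseteq> \<Omega> \<longrightarrow> test_open_in F K W)}"

definition test_topology ::
  "complex set \<Rightarrow> (real ^ 'n) set \<Rightarrow> (real ^ 'n \<Rightarrow> complex) topology" where
  "test_topology F \<Omega> =
     topology_generated_by
       {(\<lambda>\<psi> x. \<phi> x + \<psi> x) ` W | \<phi> W. \<phi> \<in> test_functions F \<Omega> \<and> W \<in> test_neighbourhoods F \<Omega>}"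

definition distributions ::
  "complex set \<Rightarrow> (real ^ 'n) set \<Rightarrow> ((real ^ 'n \<Rightarrow> complex) \<Rightarrow> complex) set" where
  "distributions F \<Omega> =
     {T. T ` test_functions F \<Omega> \<subseteq> F \<and>
         (\<forall>\<phi> \<in> test_functions F \<Omega>. \<forall>\<psi> \<in> test_functions F \<Omega>. T (\<lambda>x. \<phi> x + \<psi> x) = T \<phi> + T \<psi>) \<and>
         (\<forall>c\<in>F. \<forall>\<phi> \<in> test_functions F \<Omega>. T (\<lambda>x. c * \<phi> x) = c * T \<phi>) \<and>
         continuous_map (test_topology F \<Omega>) euclidean T}"

end

theory Submission
  imports Defs
begin

text \<open>
  On the test functions the pairing \<open>(u, \<phi>) \<mapsto> \<integral> cnj u \<sqdot> \<phi>\<close> over \<open>\<Omega>\<close> is linear in \<open>\<phi>\<close>, hermitian and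
  definite: a continuous function supported in \<open>\<Omega>\<close> that vanishes almost everywhere vanishes.  On
  the span of finitely many test functions it is therefore an inner product, and every linear
  functional \<open>T\<close> on test functions agrees, on these finitely many functions, with the pairing with
  some element \<open>w\<close> of their span (\<open>finite_riesz_representation\<close>).

  For a finite subset \<open>A\<close> of the universe this is applied to the finite set \<open>B A\<close> of those test
  functions \<open>\<phi>\<close> for which \<open>cnj \<phi>\<close>, and in the complex case also \<open>\<i> cnj \<phi>\<close>, belongs to \<open>A\<close>.  Then
  \<open>u A = cnj w\<close> satisfies \<open>\<integral> u A \<sqdot> \<phi> = T \<phi>\<close> for all \<open>\<phi>\<close> in \<open>B A\<close>, and it lies in the span of \<open>V \<inter> A\<close>.
  The functions \<open>\<i> cnj \<phi>\<close> are there for the case of a real vector space \<open>V\<close> of complex functions: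
  \<open>w\<close> has complex coefficients, whereas the span of \<open>V \<inter> A\<close> has real ones (\<open>cnj_span_in_V_fin\<close>).
  Every test function \<open>\<phi>\<close> belongs to \<open>B A\<close> as soon as \<open>A\<close> contains the two functions in question, so
  the net \<open>\<integral> u A \<sqdot> \<phi>\<close> is eventually equal to \<open>T \<phi>\<close>, and so is its \<open>\<Lambda>\<close>-limit.  The ultrafunction
  sought is the \<open>\<Lambda>\<close>-limit of the net \<open>u\<close>.

  Two further points are needed.  The values of limit functions and of the extended integral are
  defined by unique descriptions, so uniqueness has to be established.  It holds because two nets
  have the same \<open>\<Lambda>\<close>-limit exactly when they agree on an index set that is large in the sense of an
  ultrafilter (\<open>llim_eq_iff\<close>, \<open>star_integral_eq\<close>).  And \<open>B A\<close> is finite because a function that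
  vanishes outside the closure of \<open>\<Omega>\<close> is determined by the element of the universe that encodes it
  (\<open>fun_code_eq_imp_eq_on\<close>).
\<close>

section \<open>The \<open>\<Lambda>\<close>-limit as a reduction modulo an ultrafilter\<close>

text \<open>
  The exceptional indices form a negligible set when their indicator function has limit zero.  As
  the limit of an indicator function is an idempotent of a field, the sets with negligible
  complement form an ultrafilter; only the filter properties are derived below.
\<close>

definition almost_all :: "(('u fset \<Rightarrow> real) \<Rightarrow> 'k::zero) \<Rightarrow> ('u fset \<Rightarrow> bool) \<Rightarrow> bool" where
  "almost_all llim P \<longleftrightarrow> llim (\<lambda>A. if P A then 0 else 1) = 0"

context
  fixes llim :: "('u fset \<Rightarrow> real) \<Rightarrow> 'k::{linordered_field, real_field}"
  assumes llim: "lambda_limit llim"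
begin

lemma llim_add: "llim (\<lambda>A. \<phi> A + \<psi> A) = llim \<phi> + llim \<psi>"
  and llim_mult: "llim (\<lambda>A. \<phi> A * \<psi> A) = llim \<phi> * llim \<psi>"
  using llim unfolding lambda_limit_def by blast+

lemma llim_eventually_const: "(\<And>A. A0 |\<subseteq>| A \<Longrightarrow> \<phi> A = r) \<Longrightarrow> llim \<phi> = of_real r"
  using llim unfolding lambda_limit_def by blast

lemma llim_const: "llim (\<lambda>_. r) = of_real r"
  by (rule llim_eventually_const) simp

lemma llim_diff: "llim (\<lambda>A. \<phi> A - \<psi> A) = llim \<phi> - llim \<psi>"
  using llim_add[of \<phi> "\<lambda>A. -1 * \<psi> A"] llim_mult[of "\<lambda>_. -1" \<psi>] llim_const[of "-1"] by simp

text \<open>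
  Multiplying a net by its pointwise inverse turns it into the indicator function of its support,
  and multiplying by that indicator function gives the net back.  So the kernel of the ring
  homomorphism \<open>llim\<close> is determined by the supports of its elements.
\<close>

lemma llim_eq_0_iff: "llim \<phi> = 0 \<longleftrightarrow> almost_all llim (\<lambda>A. \<phi> A = 0)"
proof
  assume "llim \<phi> = 0"
  moreover have "(\<lambda>A. if \<phi> A = 0 then 0 else 1) = (\<lambda>A. \<phi> A * inverse (\<phi> A))"
    by auto
  ultimately show "almost_all llim (\<lambda>A. \<phi> A = 0)"
    by (simp add: almost_all_def llim_mult)
next
  assume "almost_all llim (\<lambda>A. \<phi> A = 0)"
  moreover have "\<phi> = (\<lambda>A. \<phi> A * (if \<phi> A = 0 then 0 else 1))"
    by auto
  ultimately show "llim \<phi> = 0"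
    using llim_mult[of \<phi> "\<lambda>A. if \<phi> A = 0 then 0 else 1"] by (simp add: almost_all_def)
qed

lemma llim_eq_iff: "llim \<phi> = llim \<psi> \<longleftrightarrow> almost_all llim (\<lambda>A. \<phi> A = \<psi> A)"
  using llim_eq_0_iff[of "\<lambda>A. \<phi> A - \<psi> A"] by (simp add: llim_diff)

lemma almost_all_superset: "(\<And>A. A0 |\<subseteq>| A \<Longrightarrow> P A) \<Longrightarrow> almost_all llim P"
  unfolding almost_all_def using llim_eventually_const[of A0 _ 0] by simp

lemma almost_all_mono:
  assumes "almost_all llim P" and "\<And>A. P A \<Longrightarrow> Q A"
  shows "almost_all llim Q"
proof -
  have "(\<lambda>A. if Q A then 0 else 1) = (\<lambda>A. (if P A then 0 else 1) * (if Q A then 0 else 1 :: real))"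
    using assms(2) by auto
  then show ?thesis
    using assms(1) by (simp add: almost_all_def llim_mult)
qed

lemma almost_all_conj:
  assumes "almost_all llim P" and "almost_all llim Q"
  shows "almost_all llim (\<lambda>A. P A \<and> Q A)"
proof -
  have "(\<lambda>A. if P A \<and> Q A then 0 else 1) =
    (\<lambda>A. ((if P A then 0 else 1) + (if Q A then 0 else 1)) -
          (if P A then 0 else 1) * (if Q A then 0 else 1 :: real))"
    by auto
  then show ?thesis
    using assms by (simp add: almost_all_def llim_mult llim_diff llim_add)
qed

lemma almost_all_finite:
  assumes "finite I" and "\<And>i. i \<in> I \<Longrightarrow> almost_all llim (P i)"
  shows "almost_all llim (\<lambda>A. \<forall>i\<in>I. P i A)"
  using assms
proof (induction I)
  case empty
  then show ?case by (simp add: almost_all_superset)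
next
  case (insert i I)
  then show ?case
    using almost_all_conj[of "P i" "\<lambda>A. \<forall>i\<in>I. P i A"] by simp
qed

lemma lim_vec_eq_iff: "lim_vec llim x = lim_vec llim y \<longleftrightarrow> almost_all llim (\<lambda>A. x A = y A)"
proof
  assume "lim_vec llim x = lim_vec llim y"
  then have "almost_all llim (\<lambda>A. x A $ i = y A $ i)" for i
    by (simp add: lim_vec_def vec_eq_iff llim_eq_iff)
  then have "almost_all llim (\<lambda>A. \<forall>i\<in>UNIV. x A $ i = y A $ i)"
    by (intro almost_all_finite) auto
  then show "almost_all llim (\<lambda>A. x A = y A)"
    by (simp add: vec_eq_iff)
next
  assume "almost_all llim (\<lambda>A. x A = y A)"
  then show "lim_vec llim x = lim_vec llim y"
    by (auto simp: lim_vec_def vec_eq_iff llim_eq_iff elim: almost_all_mono)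
qed

lemma lim_complex_eq_iff:
  "lim_complex llim z = lim_complex llim w \<longleftrightarrow> almost_all llim (\<lambda>A. z A = w A)"
proof
  assume "lim_complex llim z = lim_complex llim w"
  then show "almost_all llim (\<lambda>A. z A = w A)"
    using almost_all_conj by (simp add: lim_complex_def llim_eq_iff complex_eq_iff)
next
  assume "almost_all llim (\<lambda>A. z A = w A)"
  then show "lim_complex llim z = lim_complex llim w"
    by (auto simp: lim_complex_def llim_eq_iff elim: almost_all_mono)
qed

lemma lim_complex_mult:
  "lim_complex llim (\<lambda>A. z A * w A) = lim_complex llim z * lim_complex llim w"
  by (simp add: lim_complex_def times_star_complex_def llim_mult llim_diff llim_add)

lemma lim_complex_eventually_const:
  assumes "\<And>A. A0 |\<subseteq>| A \<Longrightarrow> z A = c"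
  shows "lim_complex llim z = star_of_complex c"
proof -
  have "lim_complex llim z = lim_complex llim (\<lambda>_. c)"
    using assms by (auto simp: lim_complex_eq_iff intro: almost_all_superset)
  then show ?thesis
    by (simp add: lim_complex_def star_of_complex_def llim_const)
qed


section \<open>Limits of functions and the extended integral\<close>

text \<open>
  The value of a limit function at \<open>lim_vec llim x\<close> does not depend on the net \<open>x\<close> representing this
  point, since another representative takes the same values at almost all indices.
\<close>

lemma lim_fun_lim_vec:
  assumes "\<And>A. x A \<in> E"
  shows "lim_fun llim E f (lim_vec llim x) = lim_complex llim (\<lambda>A. f A (x A))"
proof -
  have "(THE \<eta>. \<exists>y. (\<forall>A. y A \<in> E) \<and> lim_vec llim x = lim_vec llim y \<and>
      \<eta> = lim_complex llim (\<lambda>A. f A (y A))) = lim_complex llim (\<lambda>A. f A (x A))"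
  proof (rule the_equality)
    show "\<exists>y. (\<forall>A. y A \<in> E) \<and> lim_vec llim x = lim_vec llim y \<and>
        lim_complex llim (\<lambda>A. f A (x A)) = lim_complex llim (\<lambda>A. f A (y A))"
      using assms by (intro exI[of _ x]) simp
  next
    fix \<eta>
    assume "\<exists>y. (\<forall>A. y A \<in> E) \<and> lim_vec llim x = lim_vec llim y \<and>
        \<eta> = lim_complex llim (\<lambda>A. f A (y A))"
    then obtain y where xy: "almost_all llim (\<lambda>A. x A = y A)"
      and \<eta>: "\<eta> = lim_complex llim (\<lambda>A. f A (y A))"
      by (auto simp: lim_vec_eq_iff)
    have "almost_all llim (\<lambda>A. f A (y A) = f A (x A))"
      by (rule almost_all_mono[OF xy]) simp
    then show "\<eta> = lim_complex llim (\<lambda>A. f A (x A))"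
      unfolding \<eta> lim_complex_eq_iff .
  qed
  moreover have "lim_vec llim x \<in> star_set llim E"
    using assms by (auto simp: star_set_def)
  ultimately show ?thesis
    by (simp add: lim_fun_def)
qed

text \<open>
  A net of points at which \<open>f A\<close> and \<open>g A\<close> differ, whenever there are such points, defines a point
  at which the two limit functions differ, unless \<open>f A\<close> and \<open>g A\<close> agree on \<open>E\<close> for almost all \<open>A\<close>.
\<close>

lemma lim_fun_eq_imp_almost_all:
  assumes "\<And>\<xi>. \<xi> \<in> star_set llim E \<Longrightarrow> lim_fun llim E f \<xi> = lim_fun llim E g \<xi>"
  shows "almost_all llim (\<lambda>A. \<forall>x\<in>E. f A x = g A x)"
proof (cases "E = {}")
  case True
  then show ?thesis by (simp add: almost_all_superset)
next
  case False
  then have "\<exists>x. x \<in> E \<and> ((\<exists>y\<in>E. f A y \<noteq> g A y) \<longrightarrow> f A x \<noteq> g A x)" for A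
    by blast
  then obtain x where x: "\<And>A. x A \<in> E"
    "\<And>A. (\<exists>y\<in>E. f A y \<noteq> g A y) \<Longrightarrow> f A (x A) \<noteq> g A (x A)"
    by metis
  have "lim_vec llim x \<in> star_set llim E"
    using x(1) by (auto simp: star_set_def)
  then have "lim_complex llim (\<lambda>A. f A (x A)) = lim_complex llim (\<lambda>A. g A (x A))"
    using assms x(1) by (metis lim_fun_lim_vec)
  then have "almost_all llim (\<lambda>A. f A (x A) = g A (x A))"
    by (simp add: lim_complex_eq_iff)
  then show ?thesis
    by (rule almost_all_mono) (use x(2) in blast)
qed

text \<open>
  Two nets of integrable functions with the same limit function agree on \<open>\<Omega>\<close> for almost all
  indices, hence so do their integrals.  This is the uniqueness which makes the definition of the
  extended integral meaningful.
\<close>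

lemma star_integral_eq:
  assumes f: "\<And>A. f A \<in> L1_functions \<Omega>"
    and g: "\<And>\<xi>. \<xi> \<in> star_set llim \<Omega> \<Longrightarrow> g \<xi> = lim_fun llim \<Omega> f \<xi>"
  shows "star_integral llim \<Omega> g = lim_complex llim (\<lambda>A. \<integral>x. f A x \<partial>lebesgue_on \<Omega>)"
  unfolding star_integral_def
proof (rule the_equality)
  fix \<eta>
  assume "\<exists>h. (\<forall>A. h A \<in> L1_functions \<Omega>) \<and> (\<forall>\<xi>\<in>star_set llim \<Omega>. g \<xi> = lim_fun llim \<Omega> h \<xi>) \<and>
              \<eta> = lim_complex llim (\<lambda>A. \<integral>x. h A x \<partial>lebesgue_on \<Omega>)"
  then obtain h where h: "\<And>\<xi>. \<xi> \<in> star_set llim \<Omega> \<Longrightarrow> g \<xi> = lim_fun llim \<Omega> h \<xi>"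
    and \<eta>: "\<eta> = lim_complex llim (\<lambda>A. \<integral>x. h A x \<partial>lebesgue_on \<Omega>)"
    by blast
  have "almost_all llim (\<lambda>A. \<forall>x\<in>\<Omega>. h A x = f A x)"
    using g h by (intro lim_fun_eq_imp_almost_all) simp
  then have "almost_all llim (\<lambda>A. (\<integral>x. h A x \<partial>lebesgue_on \<Omega>) = (\<integral>x. f A x \<partial>lebesgue_on \<Omega>))"
    by (rule almost_all_mono) (auto intro!: Bochner_Integration.integral_cong)
  then show "\<eta> = lim_complex llim (\<lambda>A. \<integral>x. f A x \<partial>lebesgue_on \<Omega>)"
    by (simp add: \<eta> lim_complex_eq_iff)
next
  show "\<exists>h. (\<forall>A. h A \<in> L1_functions \<Omega>) \<and> (\<forall>\<xi>\<in>star_set llim \<Omega>. g \<xi> = lim_fun llim \<Omega> h \<xi>) \<and>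
      lim_complex llim (\<lambda>A. \<integral>x. f A x \<partial>lebesgue_on \<Omega>) = lim_complex llim (\<lambda>A. \<integral>x. h A x \<partial>lebesgue_on \<Omega>)"
    using f g by (intro exI[of _ f]) simp
qed

lemma star_integral_ultrafunction_mult:
  assumes "\<And>A. (\<lambda>x. u A x * \<phi> x) \<in> L1_functions \<Omega>"
  shows "star_integral llim \<Omega> (\<lambda>\<xi>. lim_fun llim (closure \<Omega>) u \<xi> * star_fun llim \<Omega> \<phi> \<xi>) =
         lim_complex llim (\<lambda>A. \<integral>x. u A x * \<phi> x \<partial>lebesgue_on \<Omega>)"
proof (rule star_integral_eq[OF assms])
  fix \<xi> assume "\<xi> \<in> star_set llim \<Omega>"
  then obtain x where x: "\<And>A. x A \<in> \<Omega>" "\<xi> = lim_vec llim x"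
    by (auto simp: star_set_def)
  moreover from this have "\<And>A. x A \<in> closure \<Omega>"
    using closure_subset by blast
  ultimately show "lim_fun llim (closure \<Omega>) u \<xi> * star_fun llim \<Omega> \<phi> \<xi> =
      lim_fun llim \<Omega> (\<lambda>A x. u A x * \<phi> x) \<xi>"
    by (simp add: star_fun_def lim_fun_lim_vec lim_complex_mult)
qed

end


section \<open>Functions are determined by their codes\<close>

context
  fixes atom :: "real \<Rightarrow> 'u" and elts :: "'u \<Rightarrow> 'u set"
  assumes superstructure: "superstructure atom elts"
begin

abbreviation (input) "level \<equiv> universe_level atom elts"

lemma atom_eq_iff: "atom r = atom s \<longleftrightarrow> r = s"
  using superstructure by (auto simp: superstructure_def inj_eq)

lemma level_mono: "m \<le> n \<Longrightarrow> level m \<subseteq> level n"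
  by (rule lift_Suc_mono_le) auto

text \<open>
  A set of elements of the universe is itself an element only if it is contained in one level, so
  all facts about the encoding keep track of levels.
\<close>

lemma mk_set:
  assumes "A \<subseteq> level n"
  shows "mk_set atom elts A \<notin> range atom" "elts (mk_set atom elts A) = A"
    "mk_set atom elts A \<in> level (Suc n)"
proof -
  have "\<exists>!x. x \<notin> range atom \<and> elts x = A"
  proof (rule ex_ex1I)
    show "\<exists>x. x \<notin> range atom \<and> elts x = A"
      using superstructure assms unfolding superstructure_def by blast
    have "inj_on elts (- range atom)"
      using superstructure unfolding superstructure_def by blast
    then show "x = y" if "x \<notin> range atom \<and> elts x = A" "y \<notin> range atom \<and> elts y = A" for x y
      using that by (auto dest: inj_onD)
  qed
  from theI'[OF this] show 1: "mk_set atom elts A \<notin> range atom" "elts (mk_set atom elts A) = A"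
    unfolding mk_set_def by blast+
  then show "mk_set atom elts A \<in> level (Suc n)"
    using assms by simp
qed

lemma kuratowski_pair:
  assumes "a \<in> level n" "b \<in> level n"
  shows "kuratowski_pair atom elts a b \<in> level (Suc (Suc n))"
    "kuratowski_pair atom elts a b \<notin> range atom"
    "elts ` elts (kuratowski_pair atom elts a b) = {{a}, {a, b}}"
proof -
  have sub: "{a} \<subseteq> level n" "{a, b} \<subseteq> level n"
    using assms by auto
  then have sub': "{mk_set atom elts {a}, mk_set atom elts {a, b}} \<subseteq> level (Suc n)"
    using mk_set(3) by blast
  show "kuratowski_pair atom elts a b \<in> level (Suc (Suc n))"
    "kuratowski_pair atom elts a b \<notin> range atom"
    unfolding kuratowski_pair_def by (rule mk_set[OF sub'])+
  show "elts ` elts (kuratowski_pair atom elts a b) = {{a}, {a, b}}"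
    unfolding kuratowski_pair_def mk_set(2)[OF sub']
    by (simp add: mk_set(2)[OF sub(1)] mk_set(2)[OF sub(2)])
qed

text \<open>
  Applying \<open>elts\<close> to a pair and to its two members recovers the set \<open>{{a}, {a, b}}\<close>, which
  reduces the claim to Kuratowski's argument for ordinary sets.
\<close>

lemma kuratowski_pair_eq_iff:
  assumes "a \<in> level n" "b \<in> level n" "c \<in> level n" "d \<in> level n"
  shows "kuratowski_pair atom elts a b = kuratowski_pair atom elts c d \<longleftrightarrow> a = c \<and> b = d"
proof
  assume "kuratowski_pair atom elts a b = kuratowski_pair atom elts c d"
  then have "{{a}, {a, b}} = {{c}, {c, d}}"
    using kuratowski_pair(3)[OF assms(1,2)] kuratowski_pair(3)[OF assms(3,4)] by simp
  then show "a = c \<and> b = d"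
    by (auto simp: doubleton_eq_iff)
qed simp

lemma atom_level: "atom r \<in> level 0"
  by simp

lemma complex_code_level: "complex_code atom elts z \<in> level 2"
proof -
  have "atom r \<in> level 2" for r
    using atom_level level_mono[of 0 2] by blast
  then show ?thesis
    using kuratowski_pair(1)[OF atom_level atom_level]
    by (simp add: complex_code_def numeral_2_eq_2 del: universe_level.simps)
qed

text \<open>
  Real numbers are encoded as urelements and all other numbers as pairs; a pair is never a
  urelement, so the two kinds of codes do not collide.
\<close>

lemma complex_code_eq_iff: "complex_code atom elts z = complex_code atom elts w \<longleftrightarrow> z = w"
proof
  assume eq: "complex_code atom elts z = complex_code atom elts w"
  have "kuratowski_pair atom elts (atom r) (atom s) \<noteq> atom t" for r s t
    using kuratowski_pair(2)[OF atom_level atom_level] by (metis rangeI)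
  note pair_noteq_atom = this this[symmetric]
  show "z = w"
    using eq
    by (cases "z \<in> \<real>"; cases "w \<in> \<real>")
      (simp_all add: complex_code_def pair_noteq_atom atom_eq_iff complex_eq_iff
        complex_is_Real_iff kuratowski_pair_eq_iff[OF atom_level atom_level atom_level atom_level])
qed simp

lemma inj_coord_index: "inj (coord_index :: 'n::finite \<Rightarrow> nat)"
proof -
  have "\<exists>e :: 'n \<Rightarrow> nat. bij_betw e UNIV {1..CARD('n)}"
    using finite_same_card_bij[of "UNIV :: 'n set" "{1..CARD('n)}"] by simp
  then have "bij_betw (coord_index :: 'n \<Rightarrow> nat) UNIV {1..CARD('n)}"
    unfolding coord_index_def by (rule someI_ex)
  then show ?thesis
    by (rule bij_betw_imp_inj_on)
qed

lemma vec_code_elts: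
  fixes x :: "real ^ 'n"
  defines "G \<equiv> range (\<lambda>i. kuratowski_pair atom elts (atom (real (coord_index i))) (atom (x $ i)))"
  shows "elts (vec_code atom elts x) = G" "vec_code atom elts x \<in> level 3"
proof -
  have "G \<subseteq> level (Suc (Suc 0))"
    unfolding G_def using kuratowski_pair(1)[OF atom_level atom_level] by blast
  then show "elts (vec_code atom elts x) = G" "vec_code atom elts x \<in> level 3"
    using mk_set(2,3) unfolding vec_code_def G_def numeral_3_eq_3 by blast+
qed

lemma vec_code_eq_iff: "vec_code atom elts x = vec_code atom elts y \<longleftrightarrow> x = y"
proof
  assume "vec_code atom elts x = vec_code atom elts y"
  then have eq: "range (\<lambda>i. kuratowski_pair atom elts (atom (real (coord_index i))) (atom (x $ i))) =
    range (\<lambda>i. kuratowski_pair atom elts (atom (real (coord_index i))) (atom (y $ i)))"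
    using vec_code_elts(1) by metis
  have "x $ i = y $ i" for i
  proof -
    obtain j where "kuratowski_pair atom elts (atom (real (coord_index i))) (atom (x $ i)) =
        kuratowski_pair atom elts (atom (real (coord_index j))) (atom (y $ j))"
      using eq by (metis (no_types, lifting) rangeE rangeI)
    then have "coord_index i = coord_index j" "x $ i = y $ j"
      by (auto simp: kuratowski_pair_eq_iff[OF atom_level atom_level atom_level atom_level] atom_eq_iff)
    then show ?thesis
      using inj_coord_index by (metis injD)
  qed
  then show "x = y"
    by (simp add: vec_eq_iff)
qed simp

lemma fun_code_eq_imp_eq_on:
  assumes "fun_code atom elts E f = fun_code atom elts E g" and "x \<in> E"
  shows "f x = g x"
proof -
  let ?pair = "\<lambda>h x. kuratowski_pair atom elts (vec_code atom elts x) (complex_code atom elts (h x))"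
  have level3: "complex_code atom elts z \<in> level 3" for z
    using complex_code_level level_mono[of 2 3] by auto
  then have "?pair h y \<in> level (Suc (Suc 3))" for h y
    using kuratowski_pair(1) vec_code_elts(2) by blast
  then have "?pair h ` E \<subseteq> level (Suc (Suc 3))" for h
    by blast
  then have "elts (fun_code atom elts E h) = ?pair h ` E" for h
    unfolding fun_code_def by (rule mk_set(2))
  then have "?pair f ` E = ?pair g ` E"
    using assms(1) by metis
  then obtain y where "?pair f x = ?pair g y"
    using assms(2) by (metis (no_types, lifting) imageE imageI)
  then show ?thesis
    by (auto simp: kuratowski_pair_eq_iff[OF vec_code_elts(2) level3 vec_code_elts(2) level3]
        vec_code_eq_iff complex_code_eq_iff)
qed

end


section \<open>Subspaces, spans and functionals\<close>

lemma scalars_closed: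
  assumes "F \<in> {\<real>, UNIV :: complex set}"
  shows "0 \<in> F" "1 \<in> F" "-1 \<in> F" "of_real r \<in> F" "a \<in> F \<Longrightarrow> b \<in> F \<Longrightarrow> a + b \<in> F"
    "a \<in> F \<Longrightarrow> b \<in> F \<Longrightarrow> a - b \<in> F" "a \<in> F \<Longrightarrow> b \<in> F \<Longrightarrow> a * b \<in> F"
    "a \<in> F \<Longrightarrow> b \<in> F \<Longrightarrow> a / b \<in> F" "a \<in> F \<Longrightarrow> cnj a \<in> F"
  using assms by (auto simp: Reals_cnj_iff)

lemma function_span_subspace:
  assumes F: "F \<in> {\<real>, UNIV}"
  shows "function_subspace F (function_span F B)"
  unfolding function_subspace_def
proof (intro conjI ballI)
  show "(\<lambda>_. 0) \<in> function_span F B"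
    unfolding function_span_def by (auto intro!: exI[of _ "{}"])
next
  fix f g assume "f \<in> function_span F B" "g \<in> function_span F B"
  then obtain s c t d where s: "finite s" "s \<subseteq> B" "\<forall>h\<in>s. c h \<in> F" "f = (\<lambda>x. \<Sum>h\<in>s. c h * h x)"
    and t: "finite t" "t \<subseteq> B" "\<forall>h\<in>t. d h \<in> F" "g = (\<lambda>x. \<Sum>h\<in>t. d h * h x)"
    unfolding function_span_def by blast
  define c' where "c' h = (if h \<in> s then c h else 0)" for h
  define d' where "d' h = (if h \<in> t then d h else 0)" for h
  have "f = (\<lambda>x. \<Sum>h\<in>s \<union> t. c' h * h x)" "g = (\<lambda>x. \<Sum>h\<in>s \<union> t. d' h * h x)"
    unfolding s(4) t(4) c'_def d'_def using s(1) t(1)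
    by (auto intro!: sum.mono_neutral_cong_left)
  then have "(\<lambda>x. f x + g x) = (\<lambda>x. \<Sum>h\<in>s \<union> t. (c' h + d' h) * h x)"
    by (simp add: sum.distrib distrib_right)
  moreover have "\<forall>h\<in>s \<union> t. c' h + d' h \<in> F"
    using s(3) t(3) scalars_closed(1,5)[OF F] by (simp add: c'_def d'_def)
  ultimately show "(\<lambda>x. f x + g x) \<in> function_span F B"
    unfolding function_span_def using s(1,2) t(1,2)
    by (intro CollectI exI[of _ "s \<union> t"] exI[of _ "\<lambda>h. c' h + d' h"]) simp
next
  fix c f assume c: "c \<in> F" and "f \<in> function_span F B"
  then obtain t d where t: "finite t" "t \<subseteq> B" "\<forall>h\<in>t. d h \<in> F" "f = (\<lambda>x. \<Sum>h\<in>t. d h * h x)"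
    unfolding function_span_def by blast
  then have "(\<lambda>x. c * f x) = (\<lambda>x. \<Sum>h\<in>t. (c * d h) * h x)"
    by (simp add: sum_distrib_left mult.assoc)
  then show "(\<lambda>x. c * f x) \<in> function_span F B"
    unfolding function_span_def using t c scalars_closed(7)[OF F]
    by (intro CollectI exI[of _ t] exI[of _ "\<lambda>h. c * d h"]) simp
qed

lemma function_span_superset: "1 \<in> F \<Longrightarrow> f \<in> B \<Longrightarrow> f \<in> function_span F B"
  unfolding function_span_def by (auto intro!: exI[of _ "{f}"] exI[of _ "\<lambda>_. 1"])

lemma function_span_mono: "B \<subseteq> C \<Longrightarrow> function_span F B \<subseteq> function_span F C"
  unfolding function_span_def by blast

lemma function_subspace_add: "function_subspace F V \<Longrightarrow> f \<in> V \<Longrightarrow> g \<in> V \<Longrightarrow> (\<lambda>x. f x + g x) \<in> V"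
  and function_subspace_scale: "function_subspace F V \<Longrightarrow> c \<in> F \<Longrightarrow> f \<in> V \<Longrightarrow> (\<lambda>x. c * f x) \<in> V"
  and function_subspace_zero: "function_subspace F V \<Longrightarrow> (\<lambda>_. 0) \<in> V"
  unfolding function_subspace_def by blast+

lemma function_span_minimal:
  assumes V: "function_subspace F V" and "B \<subseteq> V"
  shows "function_span F B \<subseteq> V"
proof
  fix f assume "f \<in> function_span F B"
  then obtain t c where t: "finite t" "t \<subseteq> B" "\<forall>h\<in>t. c h \<in> F" and f: "f = (\<lambda>x. \<Sum>h\<in>t. c h * h x)"
    unfolding function_span_def by blast
  show "f \<in> V"
    using t unfolding f
  proof (induction t)
    case empty
    then show ?case using function_subspace_zero[OF V] by simp
  next
    case (insert h t)
    have "(\<lambda>x. c h * h x) \<in> V"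
      using insert.prems assms(2) by (intro function_subspace_scale[OF V]) auto
    moreover have "(\<lambda>x. \<Sum>h\<in>t. c h * h x) \<in> V"
      using insert.prems by (intro insert.IH) auto
    ultimately show ?case
      using function_subspace_add[OF V] insert.hyps by simp
  qed
qed

definition functional_on ::
  "complex set \<Rightarrow> (real ^ 'n \<Rightarrow> complex) set \<Rightarrow> ((real ^ 'n \<Rightarrow> complex) \<Rightarrow> complex) \<Rightarrow> bool" where
  "functional_on F D T \<longleftrightarrow>
     T ` D \<subseteq> F \<and>
     (\<forall>f\<in>D. \<forall>g\<in>D. T (\<lambda>x. f x + g x) = T f + T g) \<and>
     (\<forall>c\<in>F. \<forall>f\<in>D. T (\<lambda>x. c * f x) = c * T f)"

text \<open>
  The functions on which two functionals agree form a subspace.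
\<close>

lemma functional_on_eq_on_span:
  assumes F: "F \<in> {\<real>, UNIV}" and D: "function_subspace F D"
    and P: "functional_on F D P" and Q: "functional_on F D Q"
    and "B \<subseteq> D" and "\<And>f. f \<in> B \<Longrightarrow> P f = Q f" and "f \<in> function_span F B"
  shows "P f = Q f"
proof -
  have "P (\<lambda>_. 0) = 0" "Q (\<lambda>_. 0) = 0"
    using P Q scalars_closed(1)[OF F] function_subspace_zero[OF D]
    unfolding functional_on_def by fastforce+
  then have "function_subspace F {f \<in> D. P f = Q f}"
    using D P Q by (auto simp: function_subspace_def functional_on_def)
  from function_span_minimal[OF this, of B] show ?thesis
    using assms(5-7) by blast
qed


section \<open>Riesz representation on a finite set of functions\<close>

text \<open>
  This is Gram-Schmidt orthogonalisation, one function at a time.  To pass from \<open>B\<close> to \<open>insert b B\<close>,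
  apply the induction hypothesis to the functional \<open>p b\<close>: it yields the projection \<open>q\<close> of \<open>b\<close> onto the
  span of \<open>B\<close>, and \<open>w = b - q\<close> is orthogonal to \<open>B\<close>.  If \<open>w = 0\<close>, then \<open>b\<close> lies in the span of \<open>B\<close>, and
  the function \<open>u\<close> that represents \<open>T\<close> on \<open>B\<close> also has the right value at \<open>b\<close>.  Otherwise
  \<open>p w b = p w w \<noteq> 0\<close>, and a multiple of \<open>w\<close> corrects the value at \<open>b\<close> without affecting those on
  \<open>B\<close>.  The induction has to range over all functionals because it is applied to both \<open>T\<close> and \<open>p b\<close>.
\<close>

lemma finite_riesz_representation:
  fixes D :: "(real ^ 'n \<Rightarrow> complex) set"
  assumes F: "F \<in> {\<real>, UNIV}" and D: "function_subspace F D"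
    and p: "\<And>u. u \<in> D \<Longrightarrow> functional_on F D (p u)"
    and p_cnj: "\<And>u f. u \<in> D \<Longrightarrow> f \<in> D \<Longrightarrow> p u f = cnj (p f u)"
    and p_definite: "\<And>u. u \<in> D \<Longrightarrow> p u u = 0 \<Longrightarrow> u = (\<lambda>_. 0)"
    and "finite B" and "B \<subseteq> D" and "functional_on F D T"
  shows "\<exists>u\<in>function_span F B. \<forall>f\<in>B. p u f = T f"
  using \<open>finite B\<close> \<open>B \<subseteq> D\<close> \<open>functional_on F D T\<close>
proof (induction B arbitrary: T)
  case empty
  then show ?case
    using function_subspace_zero[OF function_span_subspace[OF F]] by blast
next
  case (insert b B)
  have b: "b \<in> D" and B: "B \<subseteq> D"
    using insert.prems by auto
  have span_D: "function_span F B \<subseteq> D"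
    by (rule function_span_minimal[OF D B])
  have p_left: "p (\<lambda>x. u x + c * v x) f = p u f + cnj c * p v f"
    if "u \<in> D" "v \<in> D" "f \<in> D" "c \<in> F" for u v f c
  proof -
    have "(\<lambda>x. u x + c * v x) \<in> D"
      by (intro function_subspace_add[OF D] function_subspace_scale[OF D] that)
    then have "p (\<lambda>x. u x + c * v x) f = cnj (p f (\<lambda>x. u x + c * v x))"
      using \<open>f \<in> D\<close> by (rule p_cnj)
    also have "p f (\<lambda>x. u x + c * v x) = p f u + c * p f v"
      using p[OF \<open>f \<in> D\<close>] that function_subspace_scale[OF D] by (simp add: functional_on_def)
    also have "cnj (p f u + c * p f v) = cnj (p f u) + cnj c * cnj (p f v)"
      by simp
    also have "\<dots> = p u f + cnj c * p v f"
      using that by (simp only: p_cnj[of u f] p_cnj[of v f])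
    finally show ?thesis .
  qed
  obtain q where q: "q \<in> function_span F B" "\<And>f. f \<in> B \<Longrightarrow> p q f = p b f"
    using insert.IH[OF B p[OF b]] by blast
  obtain u where u: "u \<in> function_span F B" "\<And>f. f \<in> B \<Longrightarrow> p u f = T f"
    using insert.IH[OF B insert.prems(2)] by blast
  have D': "q \<in> D" "u \<in> D"
    using q u span_D by auto
  define w where "w = (\<lambda>x. b x + (-1) * q x)"
  have w: "w \<in> D"
    unfolding w_def
    by (intro function_subspace_add[OF D] function_subspace_scale[OF D] b D' scalars_closed[OF F])
  have w_perp: "p w f = 0" if "f \<in> B" for f
    using that B p_left[OF b D'(1) _ scalars_closed(3)[OF F], of f] q(2) by (auto simp: w_def)
  have span_insert: "function_span F B \<subseteq> function_span F (insert b B)"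
    by (rule function_span_mono) blast
  show ?case
  proof (cases "w = (\<lambda>_. 0)")
    case True
    then have "b = q"
      by (simp add: w_def fun_eq_iff)
    then have "p u b = T b"
      using functional_on_eq_on_span[OF F D p[OF D'(2)] insert.prems(2) B u(2)] q(1) by simp
    then show ?thesis
      using u span_insert by blast
  next
    case False
    have "functional_on F D (\<lambda>_. 0)"
      using scalars_closed(1)[OF F] by (auto simp: functional_on_def)
    then have "p w q = 0"
      using functional_on_eq_on_span[OF F D p[OF w] _ B w_perp q(1)] by simp
    moreover have "p w (\<lambda>x. b x + c * q x) = p w b + c * p w q" if "c \<in> F" for c
      using p[OF w] b D'(1) that function_subspace_scale[OF D that D'(1)]
      by (simp add: functional_on_def)
    from this[OF scalars_closed(3)[OF F]]
    have "p w w = p w b + (-1) * p w q"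
      by (simp only: w_def[symmetric])
    ultimately have wb: "p w b \<noteq> 0"
      using False p_definite[OF w] by auto
    \<comment> \<open>The conjugate compensates for the antilinearity of the pairing in its first argument.\<close>
    define c where "c = cnj ((T b - p u b) / p w b)"
    have "T b \<in> F" "p u b \<in> F" "p w b \<in> F"
      using insert.prems(2) p[OF D'(2)] p[OF w] b by (auto simp: functional_on_def)
    then have c: "c \<in> F"
      unfolding c_def by (intro scalars_closed[OF F])
    define v where "v = (\<lambda>x. u x + c * w x)"
    have v_eq: "p v f = p u f + (T b - p u b) / p w b * p w f" if "f \<in> D" for f
      using p_left[OF D'(2) w that c] by (simp add: v_def c_def)
    have "b \<in> function_span F (insert b B)"
      by (intro function_span_superset scalars_closed[OF F]) simp
    then have "v \<in> function_span F (insert b B)"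
      unfolding v_def w_def using u(1) q(1) span_insert
      by (intro function_subspace_add[OF function_span_subspace[OF F]]
          function_subspace_scale[OF function_span_subspace[OF F]] c scalars_closed[OF F]) auto
    moreover have "p v b = T b"
      using v_eq[OF b] wb by simp
    moreover have "p v f = T f" if "f \<in> B" for f
      using v_eq[of f] that B w_perp u(2) by auto
    ultimately show ?thesis
      by blast
  qed
qed


section \<open>Test functions\<close>

lemma infinitely_differentiable_imp_differentiable:
  "infinitely_differentiable f \<Longrightarrow> iterated_partial is f differentiable (at x)"
  by (simp add: infinitely_differentiable_def differentiable_on_def)

lemma infinitely_differentiable_imp_continuous:
  "infinitely_differentiable f \<Longrightarrow> continuous_on UNIV f"
  using infinitely_differentiable_imp_differentiable[of f "[]"]
  by (simp add: continuous_on_eq_continuous_at differentiable_imp_continuous_within)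

lemma infinitely_differentiable_zero: "infinitely_differentiable (\<lambda>_. 0)"
proof -
  have "iterated_partial is (\<lambda>_. 0) = (\<lambda>_. 0)" for "is" :: "'a list"
    by (induction "is") (simp_all add: frechet_derivative_const)
  then show ?thesis
    by (simp add: infinitely_differentiable_def)
qed

text \<open>
  Used for multiplication by a constant and for complex conjugation, both of which commute with
  every partial derivative.
\<close>

lemma infinitely_differentiable_bounded_linear:
  assumes f: "infinitely_differentiable f" and L: "bounded_linear L"
  shows "infinitely_differentiable (\<lambda>x. L (f x))"
proof -
  have deriv: "((\<lambda>x. L (iterated_partial is f x)) has_derivative
      (\<lambda>v. L (frechet_derivative (iterated_partial is f) (at x) v))) (at x)" for "is" x
    using infinitely_differentiable_imp_differentiable[OF f]
    by (intro bounded_linear.has_derivative[OF L]) (simp add: frechet_derivative_works)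
  have eq: "iterated_partial is (\<lambda>x. L (f x)) = (\<lambda>x. L (iterated_partial is f x))" for "is"
  proof (induction "is")
    case (Cons i "is")
    then show ?case
      by (simp add: frechet_derivative_at[OF deriv, symmetric])
  qed simp
  show ?thesis
    unfolding infinitely_differentiable_def eq differentiable_on_def differentiable_def
    using deriv by blast
qed

lemma infinitely_differentiable_add:
  assumes f: "infinitely_differentiable f" and g: "infinitely_differentiable g"
  shows "infinitely_differentiable (\<lambda>x. f x + g x)"
proof -
  have deriv: "((\<lambda>x. iterated_partial is f x + iterated_partial is g x) has_derivative
      (\<lambda>v. frechet_derivative (iterated_partial is f) (at x) v +
           frechet_derivative (iterated_partial is g) (at x) v)) (at x)" for "is" x
    using infinitely_differentiable_imp_differentiable[OF f]
      infinitely_differentiable_imp_differentiable[OF g]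
    by (intro has_derivative_add) (simp_all add: frechet_derivative_works)
  have eq: "iterated_partial is (\<lambda>x. f x + g x) =
      (\<lambda>x. iterated_partial is f x + iterated_partial is g x)" for "is"
  proof (induction "is")
    case (Cons i "is")
    then show ?case
      by (simp add: frechet_derivative_at[OF deriv, symmetric])
  qed simp
  show ?thesis
    unfolding infinitely_differentiable_def eq differentiable_on_def differentiable_def
    using deriv by blast
qed

lemma test_functions_support_cong:
  assumes "\<phi> \<in> test_functions F \<Omega>" "\<psi> \<in> test_functions F \<Omega>"
    and "infinitely_differentiable h" and "range h \<subseteq> F"
    and "\<And>x. h x \<noteq> 0 \<Longrightarrow> \<phi> x \<noteq> 0 \<or> \<psi> x \<noteq> 0"
  shows "h \<in> test_functions F \<Omega>"
proof -
  let ?K = "closure {x. \<phi> x \<noteq> 0} \<union> closure {x. \<psi> x \<noteq> 0}"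
  have K: "compact ?K" "?K \<subseteq> \<Omega>"
    using assms(1,2) by (auto simp: test_functions_def test_functions_in_def)
  have "closure {x. h x \<noteq> 0} \<subseteq> ?K"
    unfolding closure_Un[symmetric] using assms(5) by (intro closure_mono) auto
  moreover from this have "compact (closure {x. h x \<noteq> 0})"
    using compact_Int_closed[OF K(1) closed_closure, of "{x. h x \<noteq> 0}"] by (simp add: Int_absorb1)
  ultimately show ?thesis
    using assms(3,4) K(2) by (auto simp: test_functions_def test_functions_in_def)
qed

lemma test_functions_subspace:
  assumes F: "F \<in> {\<real>, UNIV}"
  shows "function_subspace F (test_functions F \<Omega>)"
  unfolding function_subspace_def
proof (intro conjI ballI)
  show "(\<lambda>_. 0) \<in> test_functions F \<Omega>"
    using scalars_closed(1)[OF F]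
    by (auto simp: test_functions_def test_functions_in_def infinitely_differentiable_zero)
next
  fix f g assume fg: "f \<in> test_functions F \<Omega>" "g \<in> test_functions F \<Omega>"
  then show "(\<lambda>x. f x + g x) \<in> test_functions F \<Omega>"
    using scalars_closed(5)[OF F]
    by (intro test_functions_support_cong[OF fg])
      (auto simp: test_functions_def test_functions_in_def image_subset_iff infinitely_differentiable_add)
next
  fix c f assume c: "c \<in> F" and f: "f \<in> test_functions F \<Omega>"
  then show "(\<lambda>x. c * f x) \<in> test_functions F \<Omega>"
    using scalars_closed(7)[OF F]
    by (intro test_functions_support_cong[OF f f])
      (auto simp: test_functions_def test_functions_in_def image_subset_iff
        infinitely_differentiable_bounded_linear[OF _ bounded_linear_mult_right])
qed

lemma test_functions_cnj:
  assumes F: "F \<in> {\<real>, UNIV}" and f: "f \<in> test_functions F \<Omega>"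
  shows "(\<lambda>x. cnj (f x)) \<in> test_functions F \<Omega>"
  using f scalars_closed(9)[OF F]
  by (intro test_functions_support_cong[OF f f])
    (auto simp: test_functions_def test_functions_in_def image_subset_iff
      infinitely_differentiable_bounded_linear[OF _ bounded_linear_cnj])

lemma test_functions_eq_0_outside:
  assumes "f \<in> test_functions F \<Omega>" and "x \<notin> \<Omega>"
  shows "f x = 0"
proof -
  have "closure {x. f x \<noteq> 0} \<subseteq> \<Omega>"
    using assms(1) by (simp add: test_functions_def test_functions_in_def)
  then have "{x. f x \<noteq> 0} \<subseteq> \<Omega>"
    using closure_subset by (rule order_trans[rotated])
  then show ?thesis
    using assms(2) by blast
qed

text \<open>
  A function supported in \<open>\<Omega>\<close> is smooth on the whole space, and it equals its own restriction to
  the closure of \<open>\<Omega>\<close>.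
\<close>

lemma test_functions_subset_generating_space:
  assumes "generating_space S F \<Omega> V"
  shows "test_functions F \<Omega> \<subseteq> V"
proof
  fix f assume f: "f \<in> test_functions F \<Omega>"
  then have "f = (\<lambda>x. if x \<in> closure \<Omega> then f x else 0)"
    using test_functions_eq_0_outside[OF f] closure_subset[of \<Omega>] by (auto simp: fun_eq_iff)
  moreover have "f \<in> test_functions F UNIV"
    using f by (simp add: test_functions_def test_functions_in_def)
  ultimately have "f \<in> test_functions_closure F \<Omega>"
    unfolding test_functions_closure_def by (rule image_eqI)
  then show "f \<in> V"
    using assms by (auto simp: generating_space_def)
qed

text \<open>
  The set where \<open>f\<close> does not vanish is open in the whole space and contained in \<open>\<Omega>\<close>, even if \<open>\<Omega>\<close> is
  not open.  A nonempty open set is not negligible.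
\<close>

lemma test_functions_AE_zero:
  assumes f: "f \<in> test_functions F \<Omega>" and \<Omega>: "\<Omega> \<in> sets lebesgue"
    and "AE x in lebesgue_on \<Omega>. f x = 0"
  shows "f = (\<lambda>_. 0)"
proof -
  have "AE x in lebesgue. x \<in> \<Omega> \<longrightarrow> f x = 0"
    using assms(3) \<Omega> by (subst (asm) AE_restrict_space_iff) auto
  then have AE: "AE x in lebesgue. x \<notin> {x. f x \<noteq> 0}"
    by (rule eventually_mono) (use test_functions_eq_0_outside[OF f] in blast)
  have "infinitely_differentiable f"
    using f by (simp add: test_functions_def test_functions_in_def)
  then have "open {x. f x \<noteq> 0}"
    by (intro open_Collect_neq infinitely_differentiable_imp_continuous continuous_on_const)
  moreover from this have "{x. f x \<noteq> 0} \<in> sets lebesgue"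
    by (simp add: borel_open)
  then have "negligible {x. f x \<noteq> 0}"
    using AE by (simp only: negligible_iff_null_sets AE_iff_null_sets)
  ultimately have "{x. f x \<noteq> 0} = {}"
    using open_not_negligible by blast
  then show ?thesis
    by auto
qed


section \<open>The hermitian pairing of square-integrable functions\<close>

text \<open>
  The arithmetic-geometric mean inequality bounds the product by the sum of the two squares.
\<close>

lemma L2_functions_mult_integrable:
  assumes f: "f \<in> L2_functions \<Omega>" and g: "g \<in> L2_functions \<Omega>"
  shows "integrable (lebesgue_on \<Omega>) (\<lambda>x. f x * g x)"
proof (rule Bochner_Integration.integrable_bound)
  show "integrable (lebesgue_on \<Omega>) (\<lambda>x. (norm (f x))\<^sup>2 + (norm (g x))\<^sup>2)"
    using f g by (simp add: L2_functions_def)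
  show "(\<lambda>x. f x * g x) \<in> borel_measurable (lebesgue_on \<Omega>)"
    using f g by (auto simp: L2_functions_def)
  have "norm (f x * g x) \<le> norm ((norm (f x))\<^sup>2 + (norm (g x))\<^sup>2)" for x
  proof -
    have "2 * (norm (f x) * norm (g x)) \<le> (norm (f x))\<^sup>2 + (norm (g x))\<^sup>2"
      using sum_squares_bound[of "norm (f x)" "norm (g x)"] by simp
    then show ?thesis
      by (simp add: norm_mult) (smt (verit) mult_nonneg_nonneg norm_ge_zero)
  qed
  then show "AE x in lebesgue_on \<Omega>. norm (f x * g x) \<le> norm ((norm (f x))\<^sup>2 + (norm (g x))\<^sup>2)"
    by simp
qed

lemma L2_functions_cnj: "f \<in> L2_functions \<Omega> \<Longrightarrow> (\<lambda>x. cnj (f x)) \<in> L2_functions \<Omega>"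
  by (auto simp: L2_functions_def intro: borel_measurable_continuous_on[OF continuous_on_cnj])

definition hermitian_pairing ::
  "(real ^ 'n) set \<Rightarrow> (real ^ 'n \<Rightarrow> complex) \<Rightarrow> (real ^ 'n \<Rightarrow> complex) \<Rightarrow> complex" where
  "hermitian_pairing \<Omega> u f = (\<integral>x. cnj (u x) * f x \<partial>lebesgue_on \<Omega>)"

lemma functional_on_hermitian_pairing:
  assumes F: "F \<in> {\<real>, UNIV}" and D: "D \<subseteq> L2_functions \<Omega>" and "\<And>f. f \<in> D \<Longrightarrow> range f \<subseteq> F"
    and u: "u \<in> D"
  shows "functional_on F D (hermitian_pairing \<Omega> u)"
proof -
  have int: "integrable (lebesgue_on \<Omega>) (\<lambda>x. cnj (u x) * f x)" if "f \<in> D" for f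
    using D u that by (intro L2_functions_mult_integrable L2_functions_cnj) auto
  have "hermitian_pairing \<Omega> u f \<in> F" if "f \<in> D" for f
  proof (cases "F = \<real>")
    case True
    then have "Im (u x) = 0" "Im (f x) = 0" for x
      using assms(3)[OF u] assms(3)[OF that] by (simp_all add: image_subset_iff complex_is_Real_iff)
    then have "Im (cnj (u x) * f x) = 0" for x
      by simp
    then have "Im (hermitian_pairing \<Omega> u f) = 0"
      unfolding hermitian_pairing_def integral_Im[OF int[OF that], symmetric] by simp
    then show ?thesis
      using True by (simp add: complex_is_Real_iff)
  qed (use F in auto)
  moreover have "hermitian_pairing \<Omega> u (\<lambda>x. f x + g x) = hermitian_pairing \<Omega> u f + hermitian_pairing \<Omega> u g"
    if "f \<in> D" "g \<in> D" for f g
    using int that by (simp add: hermitian_pairing_def distrib_left)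
  moreover have "hermitian_pairing \<Omega> u (\<lambda>x. c * f x) = c * hermitian_pairing \<Omega> u f" for c f
    by (simp add: hermitian_pairing_def mult.left_commute)
  ultimately show ?thesis
    unfolding functional_on_def by blast
qed

lemma hermitian_pairing_cnj: "hermitian_pairing \<Omega> u f = cnj (hermitian_pairing \<Omega> f u)"
proof -
  have "cnj (u x) * f x = cnj (cnj (f x) * u x)" for x
    by simp
  then show ?thesis
    unfolding hermitian_pairing_def by (simp only: Bochner_Integration.integral_cnj)
qed

lemma hermitian_pairing_definite:
  assumes "f \<in> test_functions F \<Omega>" and "f \<in> L2_functions \<Omega>" and "\<Omega> \<in> sets lebesgue"
    and "hermitian_pairing \<Omega> f f = 0"
  shows "f = (\<lambda>_. 0)"
proof -
  have "hermitian_pairing \<Omega> f f = complex_of_real (\<integral>x. (norm (f x))\<^sup>2 \<partial>lebesgue_on \<Omega>)"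
    unfolding hermitian_pairing_def integral_complex_of_real[symmetric]
    by (simp only: complex_norm_square mult.commute)
  then have "(\<integral>x. (norm (f x))\<^sup>2 \<partial>lebesgue_on \<Omega>) = 0"
    using assms(4) by simp
  then have "AE x in lebesgue_on \<Omega>. (norm (f x))\<^sup>2 = 0"
    using assms(2) by (subst (asm) integral_nonneg_eq_0_iff_AE) (auto simp: L2_functions_def)
  then show ?thesis
    using test_functions_AE_zero[OF assms(1,3)] by simp
qed


section \<open>Ultrafunctions representing a distribution\<close>

text \<open>
  Splitting a scalar \<open>c\<close> of \<open>F\<close> into real and imaginary part writes \<open>c \<sqdot> cnj \<phi>\<close> as a real combination
  of \<open>cnj \<phi>\<close> and \<open>\<i> cnj \<phi>\<close>.  If \<open>F\<close> consists of the real numbers, the second term vanishes, and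
  \<open>F \<inter> {1, \<i>}\<close> asks only for \<open>cnj \<phi>\<close>.
\<close>

lemma cnj_span_in_V_fin:
  fixes B V :: "(real ^ 'n \<Rightarrow> complex) set"
  assumes S: "S \<in> {\<real>, UNIV}" and F: "F \<in> {\<real>, UNIV}"
    and B: "\<And>\<phi> c. \<phi> \<in> B \<Longrightarrow> c \<in> F \<inter> {1, \<i>} \<Longrightarrow> (\<lambda>x. c * cnj (\<phi> x)) \<in> V \<and>
      fun_code atom elts (closure \<Omega>) (\<lambda>x. c * cnj (\<phi> x)) \<in> fset A"
    and w: "w \<in> function_span F B"
  shows "(\<lambda>x. cnj (w x)) \<in> V_fin atom elts S \<Omega> V A"
proof -
  define W where "W = V_fin atom elts S \<Omega> V A"
  have W: "function_subspace S W"
    unfolding W_def V_fin_def by (rule function_span_subspace[OF S])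
  \<comment> \<open>Closing the condition under scalars of \<open>F\<close> makes it an \<open>F\<close>-subspace, although \<open>W\<close> is only an \<open>S\<close>-subspace.\<close>
  define X :: "(real ^ 'n \<Rightarrow> complex) set" where "X = {w. \<forall>c\<in>F. (\<lambda>x. c * cnj (w x)) \<in> W}"
  have "function_subspace F X"
    unfolding function_subspace_def
  proof (intro conjI ballI)
    show "(\<lambda>_. 0) \<in> X"
      using function_subspace_zero[OF W] by (simp add: X_def)
    show "(\<lambda>x. f x + g x) \<in> X" if "f \<in> X" "g \<in> X" for f g
      using that function_subspace_add[OF W] by (simp add: X_def distrib_left)
    show "(\<lambda>x. d * f x) \<in> X" if "d \<in> F" "f \<in> X" for d f
    proof -
      have "(\<lambda>x. (c * cnj d) * cnj (f x)) \<in> W" if "c \<in> F" for c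
        using that \<open>d \<in> F\<close> \<open>f \<in> X\<close> scalars_closed(7,9)[OF F] by (simp add: X_def)
      then show ?thesis
        by (simp add: X_def mult.assoc)
    qed
  qed
  moreover have "B \<subseteq> X"
  proof
    fix \<phi> assume \<phi>: "\<phi> \<in> B"
    have base: "(\<lambda>x. c * cnj (\<phi> x)) \<in> W" if "c \<in> F" "c \<in> {1, \<i>}" for c
      unfolding W_def V_fin_def
      by (rule function_span_superset) (use B[OF \<phi>] that scalars_closed(2)[OF S] in auto)
    have "(\<lambda>x. c * cnj (\<phi> x)) \<in> W" if c: "c \<in> F" for c
    proof -
      have "(\<lambda>x. of_real (Re c) * (1 * cnj (\<phi> x))) \<in> W"
        using scalars_closed(2)[OF F]
        by (intro function_subspace_scale[OF W] scalars_closed[OF S] base) auto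
      moreover have "(\<lambda>x. of_real (Im c) * (\<i> * cnj (\<phi> x))) \<in> W"
      proof (cases "F = \<real>")
        case True
        then show ?thesis
          using c function_subspace_zero[OF W] by (simp add: complex_is_Real_iff)
      next
        case False
        then show ?thesis
          using F by (intro function_subspace_scale[OF W] scalars_closed[OF S] base) auto
      qed
      ultimately have "(\<lambda>x. of_real (Re c) * (1 * cnj (\<phi> x)) + of_real (Im c) * (\<i> * cnj (\<phi> x))) \<in> W"
        by (rule function_subspace_add[OF W])
      also have "(\<lambda>x. of_real (Re c) * (1 * cnj (\<phi> x)) + of_real (Im c) * (\<i> * cnj (\<phi> x))) =
          (\<lambda>x. c * cnj (\<phi> x))"
        by (subst (5) complex_eq) (simp add: algebra_simps)
      finally show ?thesis .
    qed
    then show "\<phi> \<in> X"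
      by (simp add: X_def)
  qed
  ultimately have "w \<in> X"
    using w function_span_minimal by blast
  then have "(\<lambda>x. 1 * cnj (w x)) \<in> W"
    using scalars_closed(2)[OF F] unfolding X_def by blast
  then show ?thesis
    by (simp add: W_def)
qed

theorem theorem29:
  fixes atom :: "real \<Rightarrow> 'u" and elts :: "'u \<Rightarrow> 'u set"
    and llim :: "('u fset \<Rightarrow> real) \<Rightarrow> 'k::{linordered_field, real_field}"
    and S F :: "complex set"
    and \<Omega> :: "(real ^ 'n) set"
    and V :: "(real ^ 'n \<Rightarrow> complex) set"
    and T :: "(real ^ 'n \<Rightarrow> complex) \<Rightarrow> complex"
  assumes "superstructure atom elts"
    and "lambda_limit llim"
    and "S \<in> {\<real>, UNIV}" and "F \<in> {\<real>, UNIV}" and "S \<subseteq> F"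
    and "\<Omega> \<in> sets lebesgue"
    and "generating_space S F \<Omega> V"
    and "T \<in> distributions F \<Omega>"
  shows "\<exists>u \<in> ultrafunctions atom elts llim S \<Omega> V. \<forall>\<phi> \<in> test_functions F \<Omega>.
    star_integral llim \<Omega> (\<lambda>\<xi>. u \<xi> * star_fun llim \<Omega> \<phi> \<xi>) = star_of_complex (T \<phi>)"
proof -
  note F = assms(4)
  define D where "D = test_functions F \<Omega>"
  define code where "code = fun_code atom elts (closure \<Omega>)"
  define B where "B A = {\<phi> \<in> D. \<forall>c\<in>F \<inter> {1, \<i>}. code (\<lambda>x. c * cnj (\<phi> x)) \<in> fset A}" for A
  have D: "function_subspace F D"
    unfolding D_def by (rule test_functions_subspace[OF F])
  have D_V: "D \<subseteq> V"
    unfolding D_def by (rule test_functions_subset_generating_space[OF assms(7)])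
  have V_L2: "V \<subseteq> L2_functions \<Omega>" and V: "function_subspace S V"
    using assms(7) by (auto simp: generating_space_def)
  have D_F: "range \<phi> \<subseteq> F" if "\<phi> \<in> D" for \<phi>
    using that by (simp add: D_def test_functions_def test_functions_in_def)
  have T: "functional_on F D T"
    using assms(8) by (simp add: distributions_def functional_on_def D_def)
  \<comment> \<open>Conjugation followed by encoding is injective on test functions and maps \<open>B A\<close> into \<open>A\<close>.\<close>
  have finite_B: "finite (B A)" for A
  proof (rule inj_on_finite)
    show "(\<lambda>\<phi>. code (\<lambda>x. cnj (\<phi> x))) ` B A \<subseteq> fset A"
      using scalars_closed(2)[OF F] by (auto simp: B_def dest!: bspec[of _ _ 1])
    show "inj_on (\<lambda>\<phi>. code (\<lambda>x. cnj (\<phi> x))) (B A)"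
    proof (rule inj_onI)
      fix \<phi> \<psi> assume "\<phi> \<in> B A" "\<psi> \<in> B A" and eq: "code (\<lambda>x. cnj (\<phi> x)) = code (\<lambda>x. cnj (\<psi> x))"
      then have D': "\<phi> \<in> test_functions F \<Omega>" "\<psi> \<in> test_functions F \<Omega>"
        by (auto simp: B_def D_def)
      have "\<phi> x = \<psi> x" for x
      proof (cases "x \<in> closure \<Omega>")
        case True
        then show ?thesis
          using fun_code_eq_imp_eq_on[OF assms(1) eq[unfolded code_def] True] by simp
      next
        case False
        then show ?thesis
          using D' test_functions_eq_0_outside closure_subset by (metis subsetD)
      qed
      then show "\<phi> = \<psi>"
        by blast
    qed
  qed simp
  have "\<exists>w\<in>function_span F (B A). \<forall>\<phi>\<in>B A. hermitian_pairing \<Omega> w \<phi> = T \<phi>" for A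
  proof (rule finite_riesz_representation[OF F D _ hermitian_pairing_cnj _ finite_B _ T])
    show "functional_on F D (hermitian_pairing \<Omega> \<phi>)" if "\<phi> \<in> D" for \<phi>
      using D_V V_L2 D_F that by (intro functional_on_hermitian_pairing[OF F]) blast+
    show "\<phi> = (\<lambda>_. 0)" if "\<phi> \<in> D" "hermitian_pairing \<Omega> \<phi> \<phi> = 0" for \<phi>
      using that D_V V_L2 hermitian_pairing_definite[OF _ _ assms(6)] unfolding D_def by blast
    show "B A \<subseteq> D"
      by (auto simp: B_def)
  qed
  then obtain w where w: "\<And>A. w A \<in> function_span F (B A)"
    "\<And>A \<phi>. \<phi> \<in> B A \<Longrightarrow> hermitian_pairing \<Omega> (w A) \<phi> = T \<phi>"
    by metis

  define u where "u A = (\<lambda>x. cnj (w A x))" for A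
  have u: "u A \<in> V_fin atom elts S \<Omega> V A" for A
    unfolding u_def
  proof (rule cnj_span_in_V_fin[OF assms(3) F _ w(1)])
    fix \<phi> c assume \<phi>: "\<phi> \<in> B A" and c: "c \<in> F \<inter> {1, \<i>}"
    then have "(\<lambda>x. c * cnj (\<phi> x)) \<in> D"
      using test_functions_cnj[OF F]
      by (intro function_subspace_scale[OF D]) (auto simp: B_def D_def)
    then show "(\<lambda>x. c * cnj (\<phi> x)) \<in> V \<and> fun_code atom elts (closure \<Omega>) (\<lambda>x. c * cnj (\<phi> x)) \<in> fset A"
      using D_V \<phi> c by (auto simp: B_def code_def)
  qed
  have "star_integral llim \<Omega> (\<lambda>\<xi>. lim_fun llim (closure \<Omega>) u \<xi> * star_fun llim \<Omega> \<phi> \<xi>) =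
      star_of_complex (T \<phi>)" if \<phi>: "\<phi> \<in> D" for \<phi>
  proof -
    have L1: "(\<lambda>x. u A x * \<phi> x) \<in> L1_functions \<Omega>" for A
    proof -
      have "V_fin atom elts S \<Omega> V A \<subseteq> V"
        unfolding V_fin_def by (rule function_span_minimal[OF V]) blast
      then have "u A \<in> L2_functions \<Omega>" "\<phi> \<in> L2_functions \<Omega>"
        using u[of A] \<phi> D_V V_L2 by blast+
      then show ?thesis
        unfolding L1_functions_def by (intro CollectI L2_functions_mult_integrable)
    qed
    have "star_integral llim \<Omega> (\<lambda>\<xi>. lim_fun llim (closure \<Omega>) u \<xi> * star_fun llim \<Omega> \<phi> \<xi>) =
        lim_complex llim (\<lambda>A. \<integral>x. u A x * \<phi> x \<partial>lebesgue_on \<Omega>)"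
      by (rule star_integral_ultrafunction_mult[OF assms(2) L1])
    also have "\<dots> = star_of_complex (T \<phi>)"
    proof (rule lim_complex_eventually_const[OF assms(2)])
      fix A
      assume "{|code (\<lambda>x. 1 * cnj (\<phi> x)), code (\<lambda>x. \<i> * cnj (\<phi> x))|} |\<subseteq>| A"
      then have "\<phi> \<in> B A"
        using \<phi> by (auto simp: B_def)
      then show "(\<integral>x. u A x * \<phi> x \<partial>lebesgue_on \<Omega>) = T \<phi>"
        using w(2) by (simp add: u_def hermitian_pairing_def)
    qed
    finally show ?thesis .
  qed
  moreover have "lim_fun llim (closure \<Omega>) u \<in> ultrafunctions atom elts llim S \<Omega> V"
    unfolding ultrafunctions_def using u by blast
  ultimately show ?thesis
    unfolding D_def by (intro bexI[of _ "lim_fun llim (closure \<Omega>) u"] ballI)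
qed

end
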